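(* Let $n(\epsilon,\delta')$ be the number of oracle calls made by $\mathrm{SmoothCruiser}(s,\epsilon,\delta')$ before it terminates. For any state $s\in\mathcal S$ and any $\epsilon,\delta'>0$, $$n(\epsilon,\delta')\ \le\ \frac{c_1}{\epsilon^4}\,\log\!\left(\frac{c_2}{\delta'}\right)\left[c_3\log\!\left(\frac{c_4}{\epsilon}\right)\right]^{\log_2\left(c_5\log\left(\frac{c_2}{\delta'}\right)\right)}=\tilde{\mathcal O}\!\left(\frac1{\epsilon^4}\right),$$ where $c_1,c_2,c_3,c_4$ and $c_5$ are constants that depend only on $K$, $L$ and $\gamma$.
   Context: Setting. $\mathcal S$ is a set of states of arbitrary cardinality, $\mathcal A$ a finite set of actions with $|\mathcal A|=K$, $P(\cdot|s,a)$ a transition probability on $\mathcal S$ for each $(s,a)$, $R(s,a)\in[0,1]$ a (possibly random) reward, $\gamma\in[0,1)$ the discount factor, $\lambda>0$ a regularization parameter, and $L=1/\lambda$. (Two-player turn-based zero-sum games are included by letting the state record whose turn it is.) For each state $s$, $F_s:\mathbb R^K\to\mathbb R$ is either $F_s(x)=\lambda\log\sum_{i=1}^K e^{x_i/\lambda}$ (all states in an MDP, maximizer's states in a game) or $F_s(x)=-\lambda\log\sum_{i=1}^K e^{-x_i/\lambda}$ (minimizer's states in a game). The gradient $\nabla F_s(Q)$ is always a probability vector on $\mathcal A$. The oracle, called with $(s,a)$, returns a fresh independent sample $(R,Z)$ with $Z\sim P(\cdot|s,a)$ and $R$ distributed as $R(s,a)$. The notation $\tilde{\mathcal O}$ hides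 logarithmic factors. Constants: $M_\lambda=\sup_s|F_s(0)|=\lambda\log K$ and $\kappa=(1-\sqrt\gamma)/(KL)$; $\delta'>0$ is a global parameter, and $$N(\epsilon)=\left\lceil \frac{18(1+M_\lambda)^2}{(1-\gamma)^4(1-\sqrt\gamma)^2}\,\frac{\log(2K/\delta')}{\epsilon^2}\right\rceil .$$ Algorithm. $\mathrm{SmoothCruiser}(s,\epsilon,\delta')$ computes $\widehat Q_s=\mathrm{estimateQ}(s,\epsilon)$ and outputs $F_s(\widehat Q_s)$. The two procedures below call each other recursively. $\mathrm{estimateQ}(s,\epsilon)$: for each $a\in\mathcal A$ and $i=1,\dots,N(\epsilon)$, call the oracle at $(s,a)$ to get $(R,Z)$, compute $\widehat V=\mathrm{sampleV}(Z,\epsilon/\sqrt\gamma)$ and set $q_i=R+\gamma\widehat V$; then let $\widehat Q_s(a)$ be the mean of $q_1,\dots,q_{N(\epsilon)}$ clipped to the interval $[0,(1+M_\lambda)/(1-\gamma)]$. Output $\widehat Q_s=(\widehat Q_s(a))_{a\in\mathcal A}$. $\mathrm{sampleV}(s,\epsilon)$: (1) if $\epsilon\ge(1+M_\lambda)/(1-\gamma)$, output $0$; (2) otherwise, if $\epsilon\ge\kappa$, compute $\widehat Q_s=\mathrm{estimateQ}(s,\epsilon)$ and output $F_s(\widehat Q_s)$; (3) otherwise ($\epsilon<\kappa$), compute $\widehat Q_s=\mathrm{estimateQ}(s,\sqrt{\kappa\epsilon})$, draw an action $A\sim\nabla F_s(\widehat Q_s)$, call the oracle at $(s,A)$ to get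 $(R,Z)$, compute $\widehat V=\mathrm{sampleV}(Z,\epsilon/\sqrt\gamma)$, and output $F_s(\widehat Q_s)-\widehat Q_s^{\top}\nabla F_s(\widehat Q_s)+(R+\gamma\widehat V)$. The number of oracle calls is deterministic and does not depend on $s$ or on the oracle's outputs.
   Formalization: The bound fails at ε = c4 for small δ' and is undefined for ε > c4 or δ' ≥ c2, so it is asserted for 0 < ε ≤ (1+M_λ)/(1−γ) and 0 < δ' < c2, with c2 ≥ 2K and c4 > (1+M_λ)/(1−γ); the constants are chosen after the underlying types of states and actions. *)

theory Defs
  imports "HOL-Probability.Probability" "HOL-Library.Landau_Symbols" "HOL-Library.Monad_Syntax"
begin

text \<open>
  Planning algorithms are written in a free monad. \<open>Call s a k\<close> is one call of the generative model at
  \<open>(s, a)\<close>, continuing with \<open>k (R, Z)\<close>; \<open>Draw p k\<close> draws an action from the probability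
  vector \<open>p\<close>. A program is thus the tree of all its possible executions, and every \<open>Call\<close> node
  stands for a fresh sample.
\<close>

datatype ('s, 'a, 'r) prog =
    Return 'r
  | Call 's 'a "real \<times> 's \<Rightarrow> ('s, 'a, 'r) prog"
  | Draw "'a \<Rightarrow> real" "'a \<Rightarrow> ('s, 'a, 'r) prog"

primrec bind_prog :: "('s, 'a, 'q) prog \<Rightarrow> ('q \<Rightarrow> ('s, 'a, 'r) prog) \<Rightarrow> ('s, 'a, 'r) prog" where
  "bind_prog (Return x) f = f x"
| "bind_prog (Call s a k) f = Call s a (\<lambda>w. bind_prog (k w) f)"
| "bind_prog (Draw p k) f = Draw p (\<lambda>a. bind_prog (k a) f)"

adhoc_overloading Monad_Syntax.bind \<rightleftharpoons> bind_prog

primrec for_each :: "'b list \<Rightarrow> ('b \<Rightarrow> ('s, 'a, 'r) prog) \<Rightarrow> ('s, 'a, 'r list) prog" where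
  "for_each [] f = Return []"
| "for_each (b # bs) f = do { x \<leftarrow> f b; xs \<leftarrow> for_each bs f; Return (x # xs) }"

definition call_model :: "'s \<Rightarrow> 'a \<Rightarrow> ('s, 'a, real \<times> 's) prog" where
  "call_model s a = Call s a Return"

definition draw_action :: "('a \<Rightarrow> real) \<Rightarrow> ('s, 'a, 'a) prog" where
  "draw_action p = Draw p Return"

text \<open>Constants; \<open>K\<close> is the number of actions, \<open>l\<close> is \<open>\<lambda>\<close>, \<open>g\<close> is \<open>\<gamma>\<close>, and \<open>L = 1 / l\<close>.\<close>

definition M_const :: "nat \<Rightarrow> real \<Rightarrow> real" where
  "M_const K l = l * ln (real K)"

definition max_value :: "nat \<Rightarrow> real \<Rightarrow> real \<Rightarrow> real" where
  "max_value K l g = (1 + M_const K l) / (1 - g)"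

definition kappa :: "nat \<Rightarrow> real \<Rightarrow> real \<Rightarrow> real" where
  "kappa K l g = (1 - sqrt g) / (real K * (1 / l))"

definition num_samples :: "nat \<Rightarrow> real \<Rightarrow> real \<Rightarrow> real \<Rightarrow> real \<Rightarrow> nat" where
  "num_samples K l g \<delta> \<epsilon> =
     nat \<lceil>18 * (1 + M_const K l)^2 / ((1 - g)^4 * (1 - sqrt g)^2) * (ln (2 * real K / \<delta>) / \<epsilon>^2)\<rceil>"

text \<open>
  The accuracy \<open>\<epsilon> / sqrt \<gamma>\<close> of the recursive calls. For \<open>\<gamma> = 0\<close> this quotient is infinite; since
  \<open>sampleV\<close> returns \<open>0\<close> at every accuracy from \<open>max_value\<close> on, that value serves as infinity
  (whereas \<open>\<epsilon> / 0 = 0\<close> in HOL).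
\<close>

definition coarser :: "nat \<Rightarrow> real \<Rightarrow> real \<Rightarrow> real \<Rightarrow> real" where
  "coarser K l g \<epsilon> = (if g = 0 then max_value K l g else \<epsilon> / sqrt g)"

definition clip :: "real \<Rightarrow> real \<Rightarrow> real \<Rightarrow> real" where
  "clip lo hi x = max lo (min hi x)"

definition mean :: "real list \<Rightarrow> real" where
  "mean xs = sum_list xs / real (length xs)"

text \<open>
  The states are the points of the measurable space \<open>S\<close>, the actions the entries of \<open>acts\<close>, listed
  in the order in which the algorithm processes them. \<open>Mx\<close> holds the states of the maximizer: all
  states for an MDP, an arbitrary set of states for a turn-based game. \<open>law s a\<close> is the joint
  law of one sample \<open>(R, Z)\<close>; no independence of \<open>R\<close> and \<open>Z\<close> is required.
\<close>

locale regularized_planning =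
  fixes S :: "'s measure"
    and acts :: "'a list"
    and P :: "'s \<Rightarrow> 'a \<Rightarrow> 's measure"
    and rew :: "'s \<Rightarrow> 'a \<Rightarrow> real measure"
    and law :: "'s \<Rightarrow> 'a \<Rightarrow> (real \<times> 's) measure"
    and Mx :: "'s set"
    and l g :: real
  assumes acts_ne: "acts \<noteq> []"
    and acts_distinct: "distinct acts"
    and P: "\<And>s a. s \<in> space S \<Longrightarrow> a \<in> set acts \<Longrightarrow> P s a \<in> space (prob_algebra S)"
    and rew: "\<And>s a. s \<in> space S \<Longrightarrow> a \<in> set acts \<Longrightarrow>
      rew s a \<in> space (prob_algebra (restrict_space borel {0..1}))"
    and law: "\<And>s a. s \<in> space S \<Longrightarrow> a \<in> set acts \<Longrightarrow>
      law s a \<in> space (prob_algebra (restrict_space borel {0..1} \<Otimes>\<^sub>M S))"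
    and law_fst: "\<And>s a. s \<in> space S \<Longrightarrow> a \<in> set acts \<Longrightarrow>
      distr (law s a) (restrict_space borel {0..1}) fst = rew s a"
    and law_snd: "\<And>s a. s \<in> space S \<Longrightarrow> a \<in> set acts \<Longrightarrow> distr (law s a) S snd = P s a"
    and Mx: "Mx \<subseteq> space S"
    and l_pos: "l > 0"
    and g_nonneg: "0 \<le> g"
    and g_less_1: "g < 1"
begin

abbreviation "K \<equiv> length acts"
abbreviation "vmax \<equiv> max_value K l g"
abbreviation "\<kappa> \<equiv> kappa K l g"

definition F :: "'s \<Rightarrow> ('a \<Rightarrow> real) \<Rightarrow> real" where
  "F s x = (if s \<in> Mx then l * ln (\<Sum>a\<in>set acts. exp (x a / l))
            else - l * ln (\<Sum>a\<in>set acts. exp (- x a / l)))"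

definition gradF :: "'s \<Rightarrow> ('a \<Rightarrow> real) \<Rightarrow> 'a \<Rightarrow> real" where
  "gradF s x a = deriv (\<lambda>t. F s (x(a := t))) (x a)"

text \<open>
  The numbers of calls of the generative model over all executions of a program: the response to a call at \<open>(s, a)\<close>
  is any point of the sample space of \<open>law s a\<close>, which is \<open>{0..1} \<times> space S\<close>, and a drawn
  action is any action of positive probability.
\<close>

primrec call_counts :: "('s, 'a, 'r) prog \<Rightarrow> nat set" where
  "call_counts (Return x) = {0}"
| "call_counts (Call s a k) = (\<Union>w\<in>space (law s a). Suc ` call_counts (k w))"
| "call_counts (Draw p k) = (\<Union>a\<in>{a \<in> set acts. 0 < p a}. call_counts (k a))"

lemma vmax_pos: "vmax > 0"
proof -
  have "real K \<ge> 1" using acts_ne by (cases acts) auto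
  then have "0 \<le> l * ln (real K)" using l_pos by (intro mult_nonneg_nonneg) auto
  then show ?thesis using g_less_1 by (simp add: max_value_def M_const_def)
qed

lemma kappa_pos: "\<kappa> > 0"
  using acts_ne l_pos g_less_1 by (simp add: kappa_def)

text \<open>The depth of the recursion along \<open>coarser\<close>, used for termination.\<close>

definition rank :: "real \<Rightarrow> nat" where
  "rank \<epsilon> = (LEAST n. vmax * sqrt g ^ n \<le> \<epsilon>)"

lemma rank_exists:
  assumes "\<epsilon> > 0"
  shows "\<exists>n. vmax * sqrt g ^ n \<le> \<epsilon>"
proof -
  have "\<exists>n. sqrt g ^ n < \<epsilon> / vmax"
    using assms vmax_pos g_less_1 g_nonneg by (intro real_arch_pow_inv) auto
  then show ?thesis using vmax_pos by (auto simp: field_simps intro: less_imp_le)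
qed

lemma rank_mono:
  assumes "0 < \<epsilon>" "\<epsilon> \<le> \<epsilon>'"
  shows "rank \<epsilon>' \<le> rank \<epsilon>"
proof -
  have "vmax * sqrt g ^ rank \<epsilon> \<le> \<epsilon>"
    unfolding rank_def by (rule LeastI_ex) (use rank_exists assms in blast)
  then show ?thesis using assms unfolding rank_def[of \<epsilon>'] by (intro Least_le) linarith
qed

lemma coarser_pos: "0 < \<epsilon> \<Longrightarrow> 0 < coarser K l g \<epsilon>"
  using vmax_pos g_nonneg by (auto simp: coarser_def)

lemma coarser_mono: "\<epsilon> \<le> \<epsilon>' \<Longrightarrow> coarser K l g \<epsilon> \<le> coarser K l g \<epsilon>'"
  using g_nonneg by (auto simp: coarser_def divide_right_mono)

lemma rank_coarser:
  assumes "0 < \<epsilon>" "\<epsilon> < vmax"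
  shows "rank (coarser K l g \<epsilon>) < rank \<epsilon>"
proof -
  have le: "vmax * sqrt g ^ rank \<epsilon> \<le> \<epsilon>"
    unfolding rank_def by (rule LeastI_ex) (use rank_exists assms in blast)
  obtain m where m: "rank \<epsilon> = Suc m"
    using le assms(2) by (cases "rank \<epsilon>") auto
  have "vmax * sqrt g ^ m \<le> coarser K l g \<epsilon>"
  proof (cases "g = 0")
    case True
    then show ?thesis using vmax_pos by (cases m) (auto simp: coarser_def)
  next
    case False
    then show ?thesis using le m g_nonneg by (simp add: coarser_def field_simps)
  qed
  then have "rank (coarser K l g \<epsilon>) \<le> m" unfolding rank_def by (rule Least_le)
  then show ?thesis using m by simp
qed

context
  fixes \<delta> :: real
begin

text \<open>Accuracies are positive; the test for \<open>\<epsilon> \<le> 0\<close> only makes \<open>sampleV\<close> total.\<close>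

function (sequential)
      estimateQ :: "'s \<Rightarrow> real \<Rightarrow> ('s, 'a, 'a \<Rightarrow> real) prog"
  and sampleV :: "'s \<Rightarrow> real \<Rightarrow> ('s, 'a, real) prog"
where
  "estimateQ s \<epsilon> =
     do {
       qs \<leftarrow> for_each acts (\<lambda>a.
         do {
           q \<leftarrow> for_each [0..<num_samples K l g \<delta> \<epsilon>] (\<lambda>_.
             do {
               (R, Z) \<leftarrow> call_model s a;
               V \<leftarrow> sampleV Z (coarser K l g \<epsilon>);
               Return (R + g * V)
             });
           Return (clip 0 vmax (mean q))
         });
       Return (\<lambda>a. the (map_of (zip acts qs) a))
     }"
| "sampleV s \<epsilon> =
     (if \<epsilon> \<le> 0 \<or> vmax \<le> \<epsilon> then Return 0
      else if \<kappa> \<le> \<epsilon> then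
        do {
          Q \<leftarrow> estimateQ s \<epsilon>;
          Return (F s Q)
        }
      else
        do {
          Q \<leftarrow> estimateQ s (sqrt (\<kappa> * \<epsilon>));
          A \<leftarrow> draw_action (gradF s Q);
          (R, Z) \<leftarrow> call_model s A;
          V \<leftarrow> sampleV Z (coarser K l g \<epsilon>);
          Return (F s Q - (\<Sum>a\<in>set acts. Q a * gradF s Q a) + (R + g * V))
        })"
  by pat_completeness auto

termination
proof (relation "Wellfounded.measure (\<lambda>x. case x of
    Inl (s, \<epsilon>) \<Rightarrow> 2 * rank (coarser K l g \<epsilon>) + 1
  | Inr (s, \<epsilon>) \<Rightarrow> 2 * rank \<epsilon>)", goal_cases)
  case (4 s \<epsilon>)
  then have "\<epsilon> \<le> sqrt (\<kappa> * \<epsilon>)" by (intro real_le_rsqrt) (simp add: power2_eq_square)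
  then have "rank (coarser K l g (sqrt (\<kappa> * \<epsilon>))) \<le> rank (coarser K l g \<epsilon>)"
    using 4 by (intro rank_mono coarser_mono coarser_pos) auto
  then show ?case using rank_coarser[of \<epsilon>] 4 by simp
next
  case (3 s \<epsilon>)
  then show ?case using rank_coarser[of \<epsilon>] by simp
next
  case (5 s \<epsilon>)
  then show ?case using rank_coarser[of \<epsilon>] by simp
qed auto

definition smooth_cruiser :: "'s \<Rightarrow> real \<Rightarrow> ('s, 'a, real) prog" where
  "smooth_cruiser s \<epsilon> = do { Q \<leftarrow> estimateQ s \<epsilon>; Return (F s Q) }"

end

end

definition soft_bigo :: "'b filter \<Rightarrow> ('b \<Rightarrow> real) \<Rightarrow> ('b \<Rightarrow> real) set" where
  "soft_bigo Fl h = {f. \<exists>k::nat. f \<in> O[Fl](\<lambda>x. h x * ln (h x) ^ k)}"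

definition call_bound :: "real \<Rightarrow> real \<Rightarrow> real \<Rightarrow> real \<Rightarrow> real \<Rightarrow> real \<Rightarrow> real \<Rightarrow> real" where
  "call_bound c1 c2 c3 c4 c5 \<epsilon> \<delta> =
     c1 / \<epsilon>^4 * ln (c2 / \<delta>) * (c3 * ln (c4 / \<epsilon>)) powr (log 2 (c5 * ln (c2 / \<delta>)))"

end

theory Submission
  imports Defs "HOL-Real_Asymp.Real_Asymp"
begin

text \<open>
  Let \<open>r = sqrt \<gamma>\<close> and let \<open>T \<epsilon>\<close> be the number of calls made by \<open>sampleV\<close>. Since the number of
  samples is at most a constant times \<open>ln (c2 / \<delta>) / \<epsilon>\<^sup>2\<close>, a call below accuracy \<open>\<kappa>\<close> costs
  \<open>T \<epsilon> \<le> B / (\<kappa> * \<epsilon>) * (1 + T (sqrt (\<kappa> * \<epsilon>) / r)) + 1 + T (\<epsilon> / r)\<close> with \<open>B\<close> proportional to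
  \<open>ln (c2 / \<delta>)\<close>. In a bound of order \<open>1 / \<epsilon>\<^sup>2\<close> the last summand contributes a geometric series,
  while the first multiplies the constant by \<open>Y\<close>, proportional to \<open>B\<close>, each time \<open>\<epsilon>\<close> is replaced by
  \<open>sqrt (\<kappa> * \<epsilon>) / r\<close>. The latter halves \<open>ln (\<kappa> / (r\<^sup>2 * \<epsilon>))\<close>, so it happens about
  \<open>log 2 (ln (1 / \<epsilon>))\<close> times before accuracy \<open>\<kappa>\<close> is reached; from there on \<open>\<epsilon>\<close> grows by the factor \<open>1 / r\<close>,
  for boundedly many steps \<open>m\<close>. The total factor \<open>Y ^ (m + log 2 (ln (1 / \<epsilon>)))\<close> is a power of
  \<open>ln (1 / \<epsilon>)\<close> with exponent \<open>log 2 Y\<close>.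
\<close>

section \<open>The recurrence for the number of calls, solved abstractly\<close>

locale call_recurrence =
  fixes T :: "real \<Rightarrow> real" and v \<kappa> r B D Y :: real
  assumes r_pos: "0 < r" and r_less_1: "r < 1"
    and \<kappa>_pos: "0 < \<kappa>" and v_pos: "0 < v" and B_nonneg: "0 \<le> B"
    and T_top: "\<And>\<epsilon>. v \<le> \<epsilon> \<Longrightarrow> T \<epsilon> = 0"
    and T_mid: "\<And>\<epsilon>. \<kappa> \<le> \<epsilon> \<Longrightarrow> \<epsilon> < v \<Longrightarrow> T \<epsilon> \<le> B / \<epsilon>\<^sup>2 * (1 + T (\<epsilon> / r))"
    and T_low: "\<And>\<epsilon>. 0 < \<epsilon> \<Longrightarrow> \<epsilon> < \<kappa> \<Longrightarrow> \<epsilon> < v \<Longrightarrow>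
      T \<epsilon> \<le> B / (\<kappa> * \<epsilon>) * (1 + T (sqrt (\<kappa> * \<epsilon>) / r)) + 1 + T (\<epsilon> / r)"
    and D_ge: "(max v \<kappa> / r)\<^sup>2 \<le> D"
    and Y_ge: "(2 * B / \<kappa>\<^sup>2 + 1) / (1 - r\<^sup>2) \<le> Y"
begin

lemma one_minus_r2_pos: "0 < 1 - r\<^sup>2"
  using r_pos r_less_1 by (simp add: power_less_one_iff)

text \<open>Read as \<open>2 * B / \<kappa>\<^sup>2 + 1 + Y * r\<^sup>2 \<le> Y\<close>, this is
  what a step below \<open>\<kappa>\<close> consumes: the three summands of \<open>T_low\<close>, in
  their order, fit together into one factor \<open>Y\<close>.\<close>

lemma Y_mult_ge: "2 * B / \<kappa>\<^sup>2 + 1 \<le> Y * (1 - r\<^sup>2)"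
  using Y_ge one_minus_r2_pos by (simp add: pos_divide_le_eq)

lemma Y_ge_plain: "2 * B / \<kappa>\<^sup>2 + 1 \<le> Y"
proof -
  have nn: "0 \<le> 2 * B / \<kappa>\<^sup>2 + 1" using B_nonneg by simp
  then have "0 \<le> Y" using Y_mult_ge one_minus_r2_pos
    by (meson order_trans zero_le_mult_iff not_less)
  then have "Y * (1 - r\<^sup>2) \<le> Y * 1" by (intro mult_left_mono) auto
  then show ?thesis using Y_mult_ge by simp
qed

lemma Y_ge_1: "1 \<le> Y"
proof -
  have "0 \<le> 2 * B / \<kappa>\<^sup>2" using B_nonneg by simp
  then show ?thesis using Y_ge_plain by linarith
qed

lemma D_nonneg: "0 \<le> D"
  using D_ge by (rule order_trans[rotated]) simp

lemma D_le: "D \<le> D * Y ^ j"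
  using D_nonneg Y_ge_1 by (simp add: mult_le_cancel_left1)

text \<open>\<open>D\<close> dominates the squares of all accuracies up to
  \<open>max v \<kappa> / r\<close>, which bounds the accuracies of all recursive calls. So the
  summand 1 is absorbed at the price of a factor 2.\<close>

lemma one_plus_T_le:
  assumes "0 < \<epsilon>" "\<epsilon> \<le> max v \<kappa> / r" "T \<epsilon> \<le> D * Y ^ j / \<epsilon>\<^sup>2"
  shows "1 + T \<epsilon> \<le> 2 * D * Y ^ j / \<epsilon>\<^sup>2"
proof -
  have "\<epsilon>\<^sup>2 \<le> (max v \<kappa> / r)\<^sup>2" using assms by (intro power_mono) auto
  also have "\<dots> \<le> D * Y ^ j" using D_ge D_le[of j] by linarith
  finally have "1 \<le> D * Y ^ j / \<epsilon>\<^sup>2" using assms(1) by (simp add: field_simps)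
  with assms(3) show ?thesis by simp
qed

text \<open>After \<open>j\<close> divisions by \<open>r\<close> the accuracy has reached
  \<open>v\<close>, where \<open>T\<close> vanishes. Each division costs a full factor
  \<open>Y\<close>, which is affordable only because \<open>\<kappa> \<le> \<epsilon>\<close> bounds
  their number.\<close>

lemma T_le_mid:
  assumes "\<kappa> \<le> \<epsilon>" "v * r ^ j \<le> \<epsilon>"
  shows "T \<epsilon> \<le> D * Y ^ j / \<epsilon>\<^sup>2"
  using assms
proof (induction j arbitrary: \<epsilon>)
  case 0
  then show ?case using T_top[of \<epsilon>] D_nonneg by simp
next
  case (Suc j)
  have \<epsilon>: "0 < \<epsilon>" using Suc.prems \<kappa>_pos by linarith
  show ?case
  proof (cases "v \<le> \<epsilon>")
    case True
    then show ?thesis using T_top[of \<epsilon>] D_nonneg Y_ge_1 by simp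
  next
    case False
    have "\<epsilon> \<le> \<epsilon> / r" using \<epsilon> r_pos r_less_1 by (simp add: field_simps)
    moreover have "v * r ^ j \<le> \<epsilon> / r" using Suc.prems r_pos by (simp add: field_simps)
    ultimately have "T (\<epsilon> / r) \<le> D * Y ^ j / (\<epsilon> / r)\<^sup>2" using Suc by simp
    moreover have "\<epsilon> / r \<le> max v \<kappa> / r" using False r_pos by (intro divide_right_mono) auto
    ultimately have "1 + T (\<epsilon> / r) \<le> 2 * D * Y ^ j / (\<epsilon> / r)\<^sup>2"
      using \<epsilon> r_pos by (intro one_plus_T_le) auto
    also have "\<dots> = 2 * D * Y ^ j / \<epsilon>\<^sup>2 * r\<^sup>2" by (simp add: power_divide)
    also have "\<dots> \<le> 2 * D * Y ^ j / \<epsilon>\<^sup>2 * 1"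
      using D_nonneg Y_ge_1 r_pos r_less_1 by (intro mult_left_mono) (auto simp: power_le_one)
    \<comment> \<open>\<open>T_mid\<close> brings its own \<open>1 / \<epsilon>\<^sup>2\<close>, so
      the one present here is traded for the constant \<open>1 / \<kappa>\<^sup>2\<close>; otherwise
      the order would grow with every step.\<close>
    also have "\<dots> \<le> 2 * D * Y ^ j / \<kappa>\<^sup>2"
      using Suc.prems \<kappa>_pos D_nonneg Y_ge_1 \<epsilon>
      by (simp, intro divide_left_mono power_mono mult_nonneg_nonneg) auto
    finally have le: "1 + T (\<epsilon> / r) \<le> 2 * D * Y ^ j / \<kappa>\<^sup>2" .
    have "T \<epsilon> \<le> B / \<epsilon>\<^sup>2 * (1 + T (\<epsilon> / r))" using T_mid Suc.prems False by simp
    also have "\<dots> \<le> B / \<epsilon>\<^sup>2 * (2 * D * Y ^ j / \<kappa>\<^sup>2)"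
      using le B_nonneg by (intro mult_left_mono) auto
    also have "\<dots> = (2 * B / \<kappa>\<^sup>2) * (D * Y ^ j / \<epsilon>\<^sup>2)" by (simp add: mult_ac)
    also have "\<dots> \<le> Y * (D * Y ^ j / \<epsilon>\<^sup>2)"
      using Y_ge_plain D_nonneg Y_ge_1 by (intro mult_right_mono) auto
    finally show ?thesis by (simp add: mult_ac)
  qed
qed

text \<open>The orbit of \<open>\<kappa>\<close> under
  \<open>r\<^sup>2 * \<epsilon>\<^sup>2 / \<kappa>\<close>, the inverse of
  \<open>sqrt (\<kappa> * \<epsilon>) / r\<close>. From an accuracy of at least
  \<open>threshold i\<close>, \<open>i\<close> applications of the latter map lead to
  \<open>\<kappa>\<close> or beyond.\<close>

definition threshold :: "nat \<Rightarrow> real" where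
  "threshold i = \<kappa> / r\<^sup>2 * (r\<^sup>2) ^ (2 ^ i)"

lemma threshold_pos: "0 < threshold i"
  using \<kappa>_pos r_pos by (simp add: threshold_def)

text \<open>Passing from \<open>\<epsilon>\<close> to \<open>sqrt (\<kappa> * \<epsilon>) / r\<close>, whose fixed point is \<open>\<kappa> / r\<^sup>2\<close>, halves \<open>ln (\<kappa> / (r\<^sup>2 * \<epsilon>))\<close>.\<close>

lemma threshold_Suc:
  assumes "threshold (Suc i) \<le> \<epsilon>"
  shows "threshold i \<le> sqrt (\<kappa> * \<epsilon>) / r"
proof -
  have "(r\<^sup>2) ^ (2 ^ Suc i) = ((r\<^sup>2) ^ (2 ^ i))\<^sup>2"
    by (simp add: mult.commute flip: power_mult)
  then have "(threshold i * r)\<^sup>2 = \<kappa> * threshold (Suc i)"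
    using r_pos by (simp add: threshold_def power2_eq_square)
  also have "\<dots> \<le> \<kappa> * \<epsilon>" using assms \<kappa>_pos by simp
  finally have "threshold i * r \<le> sqrt (\<kappa> * \<epsilon>)" by (rule real_le_rsqrt)
  then show ?thesis using r_pos by (simp add: field_simps)
qed

text \<open>The exponent counts \<open>m\<close> steps above \<open>\<kappa>\<close> and
  \<open>i\<close> square-root calls. The outer induction on \<open>i\<close> handles the call at
  \<open>sqrt (\<kappa> * \<epsilon>) / r\<close>, which alone raises the exponent.\<close>

lemma T_le:
  assumes m: "v * r ^ m \<le> \<kappa>"
  assumes "threshold i \<le> \<epsilon>"
  shows "T \<epsilon> \<le> D * Y ^ (m + i) / \<epsilon>\<^sup>2"
  using assms(2)
proof (induction i arbitrary: \<epsilon>)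
  case 0
  then have "\<kappa> \<le> \<epsilon>" using r_pos by (simp add: threshold_def)
  then show ?case using T_le_mid[of \<epsilon> m] m by simp
next
  case (Suc i)
  \<comment> \<open>The inner induction follows \<open>\<epsilon> / r\<close> up to
    \<open>\<kappa>\<close>. The bound must not depend on \<open>n\<close>; this works because
    \<open>(\<epsilon> / r)\<^sup>2\<close> in the denominator yields a factor
    \<open>r\<^sup>2 < 1\<close>, which makes these calls a geometric series.\<close>
  have "T \<epsilon> \<le> D * Y ^ (m + Suc i) / \<epsilon>\<^sup>2" if "threshold (Suc i) \<le> \<epsilon>" "\<kappa> * r ^ n \<le> \<epsilon>" for n \<epsilon>
    using that
  proof (induction n arbitrary: \<epsilon>)
    case 0
    then have "T \<epsilon> \<le> D * Y ^ m / \<epsilon>\<^sup>2" using T_le_mid[of \<epsilon> m] m by simp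
    also have "\<dots> \<le> D * Y ^ (m + Suc i) / \<epsilon>\<^sup>2"
      using D_nonneg Y_ge_1 by (intro divide_right_mono mult_left_mono power_increasing) auto
    finally show ?case .
  next
    case (Suc n)
    note outer = \<open>\<And>\<epsilon>. threshold i \<le> \<epsilon> \<Longrightarrow> T \<epsilon> \<le> D * Y ^ (m + i) / \<epsilon>\<^sup>2\<close>
    have \<epsilon>: "0 < \<epsilon>" using Suc.prems(1) threshold_pos[of "Suc i"] by linarith
    define X where "X = D * Y ^ (m + i)"
    have X: "0 \<le> X" using D_nonneg Y_ge_1 by (simp add: X_def)
    consider "v \<le> \<epsilon>" | "\<kappa> \<le> \<epsilon>" | "\<epsilon> < \<kappa>" "\<epsilon> < v" by linarith
    then show ?case
    proof cases
      case 1
      then show ?thesis using T_top[of \<epsilon>] D_nonneg Y_ge_1 by simp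
    next
      case 2
      then have "T \<epsilon> \<le> D * Y ^ m / \<epsilon>\<^sup>2" using T_le_mid[of \<epsilon> m] m by simp
      also have "\<dots> \<le> D * Y ^ (m + Suc i) / \<epsilon>\<^sup>2"
        using D_nonneg Y_ge_1 by (intro divide_right_mono mult_left_mono power_increasing) auto
      finally show ?thesis .
    next
      case 3
      have "\<epsilon> \<le> \<epsilon> / r" using \<epsilon> r_pos r_less_1 by (simp add: field_simps)
      moreover have "\<kappa> * r ^ n \<le> \<epsilon> / r" using Suc.prems r_pos by (simp add: field_simps)
      ultimately have "T (\<epsilon> / r) \<le> D * Y ^ (m + Suc i) / (\<epsilon> / r)\<^sup>2"
        using Suc by simp
      then have rest: "T (\<epsilon> / r) \<le> Y * X * r\<^sup>2 / \<epsilon>\<^sup>2"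
        by (simp add: X_def power_divide mult_ac)
      have "\<kappa> * \<epsilon> \<le> \<kappa> * \<kappa>" using 3 \<kappa>_pos by (intro mult_left_mono) auto
      then have "sqrt (\<kappa> * \<epsilon>) \<le> \<kappa>" using \<kappa>_pos by (intro real_le_lsqrt) (auto simp: power2_eq_square)
      then have "sqrt (\<kappa> * \<epsilon>) / r \<le> max v \<kappa> / r"
        using r_pos by (intro divide_right_mono) auto
      then have "1 + T (sqrt (\<kappa> * \<epsilon>) / r) \<le> 2 * D * Y ^ (m + i) / (sqrt (\<kappa> * \<epsilon>) / r)\<^sup>2"
        using outer threshold_Suc Suc.prems \<kappa>_pos r_pos \<epsilon>
        by (intro one_plus_T_le) auto
      also have "\<dots> = 2 * X / (\<kappa> * \<epsilon>) * r\<^sup>2"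
        using \<kappa>_pos \<epsilon> by (simp add: X_def power_divide)
      also have "\<dots> \<le> 2 * X / (\<kappa> * \<epsilon>) * 1"
        using X \<kappa>_pos \<epsilon> r_pos r_less_1 by (intro mult_left_mono) (auto simp: power_le_one)
      finally have le: "1 + T (sqrt (\<kappa> * \<epsilon>) / r) \<le> 2 * X / (\<kappa> * \<epsilon>)" by simp
      have "B / (\<kappa> * \<epsilon>) * (1 + T (sqrt (\<kappa> * \<epsilon>) / r)) \<le> B / (\<kappa> * \<epsilon>) * (2 * X / (\<kappa> * \<epsilon>))"
        using le B_nonneg \<kappa>_pos \<epsilon> by (intro mult_left_mono) auto
      also have "\<dots> = 2 * B / \<kappa>\<^sup>2 * X / \<epsilon>\<^sup>2" by (simp add: power2_eq_square mult_ac)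
      finally have first: "B / (\<kappa> * \<epsilon>) * (1 + T (sqrt (\<kappa> * \<epsilon>) / r)) \<le> 2 * B / \<kappa>\<^sup>2 * X / \<epsilon>\<^sup>2" .
      note \<open>\<epsilon> \<le> \<epsilon> / r\<close>
      also have "\<epsilon> / r \<le> max v \<kappa> / r" using 3 r_pos by (intro divide_right_mono) auto
      finally have "\<epsilon> \<le> max v \<kappa> / r" .
      then have "\<epsilon>\<^sup>2 \<le> (max v \<kappa> / r)\<^sup>2" using \<epsilon> by (intro power_mono) auto
      also have "\<dots> \<le> X" using D_ge D_le[of "m + i"] by (simp add: X_def)
      finally have one: "1 \<le> X / \<epsilon>\<^sup>2" using \<epsilon> by (simp add: field_simps)
      have "T \<epsilon> \<le> 2 * B / \<kappa>\<^sup>2 * X / \<epsilon>\<^sup>2 + X / \<epsilon>\<^sup>2 + Y * X * r\<^sup>2 / \<epsilon>\<^sup>2"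
        using T_low[of \<epsilon>] 3 \<epsilon> first one rest by linarith
      also have "\<dots> = (2 * B / \<kappa>\<^sup>2 + 1 + Y * r\<^sup>2) * (X / \<epsilon>\<^sup>2)"
        unfolding distrib_right by (simp add: mult_ac)
      also have "\<dots> \<le> Y * (X / \<epsilon>\<^sup>2)"
        using Y_mult_ge X by (intro mult_right_mono) (auto simp: algebra_simps)
      finally show ?thesis by (simp add: X_def mult_ac)
    qed
  qed
  moreover obtain n where "r ^ n < \<epsilon> / \<kappa>"
    using real_arch_pow_inv[of "\<epsilon> / \<kappa>" r] r_less_1 \<kappa>_pos Suc.prems threshold_pos[of "Suc i"]
    by auto
  then have "\<kappa> * r ^ n \<le> \<epsilon>" using \<kappa>_pos by (simp add: field_simps)
  ultimately show ?case using Suc.prems by blast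
qed

text \<open>The outermost \<open>estimateQ\<close> runs at accuracy \<open>\<epsilon>\<close>
  itself. Its factor \<open>B / \<epsilon>\<^sup>2\<close> is kept and, times the
  \<open>1 / \<epsilon>\<^sup>2\<close> of \<open>T\<close>, gives the fourth power.\<close>

lemma step_le:
  assumes m: "v * r ^ m \<le> \<kappa>" and "0 < \<epsilon>" "\<epsilon> \<le> v" "threshold i \<le> \<epsilon>"
  shows "B / \<epsilon>\<^sup>2 * (1 + T (\<epsilon> / r)) \<le> 2 * B * D * Y ^ (m + i) / \<epsilon> ^ 4"
proof -
  have "\<epsilon> \<le> \<epsilon> / r" using assms r_pos r_less_1 by (simp add: field_simps)
  then have "T (\<epsilon> / r) \<le> D * Y ^ (m + i) / (\<epsilon> / r)\<^sup>2" using assms by (intro T_le) auto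
  moreover have "\<epsilon> / r \<le> max v \<kappa> / r" using assms r_pos by (intro divide_right_mono) auto
  ultimately have "1 + T (\<epsilon> / r) \<le> 2 * D * Y ^ (m + i) / (\<epsilon> / r)\<^sup>2"
    using assms r_pos by (intro one_plus_T_le) auto
  also have "\<dots> = 2 * D * Y ^ (m + i) / \<epsilon>\<^sup>2 * r\<^sup>2" by (simp add: power_divide)
  also have "\<dots> \<le> 2 * D * Y ^ (m + i) / \<epsilon>\<^sup>2 * 1"
    using D_nonneg Y_ge_1 r_pos r_less_1 by (intro mult_left_mono) (auto simp: power_le_one)
  finally have "B / \<epsilon>\<^sup>2 * (1 + T (\<epsilon> / r)) \<le> B / \<epsilon>\<^sup>2 * (2 * D * Y ^ (m + i) / \<epsilon>\<^sup>2)"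
    using B_nonneg by (intro mult_left_mono) auto
  also have "\<dots> = 2 * B * D * Y ^ (m + i) / \<epsilon> ^ 4"
    by (simp add: power2_eq_square power4_eq_xxxx mult_ac)
  finally show ?thesis .
qed

lemma step_le_log:
  assumes m: "v * r ^ m \<le> \<kappa>"
    and c3: "2 ^ m * (2 / ln (1 / r\<^sup>2) + 1) \<le> c3"
    and c4: "exp 1 * v \<le> c4" "\<kappa> / r\<^sup>2 \<le> c4"
    and \<epsilon>: "0 < \<epsilon>" "\<epsilon> \<le> v"
  shows "B / \<epsilon>\<^sup>2 * (1 + T (\<epsilon> / r)) \<le> 2 * B * D / \<epsilon> ^ 4 * (c3 * ln (c4 / \<epsilon>)) powr log 2 Y"
proof -
  define q where "q = ln (1 / r\<^sup>2)"
  define u where "u = ln (c4 / \<epsilon>)"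
  define x where "x = u / q"
  have q: "0 < q" using r_pos one_minus_r2_pos by (simp add: q_def)
  have "0 < exp 1 * v" using v_pos by simp
  then have c4_pos: "0 < c4" using c4(1) by linarith
  \<comment> \<open>The choice of \<open>c4\<close> makes the logarithm \<open>u\<close> at least 1,
    so that an additive constant can be bounded by a multiple of \<open>u\<close>.\<close>
  have "exp 1 * \<epsilon> \<le> exp 1 * v" using \<epsilon> by simp
  then have "exp 1 * \<epsilon> \<le> c4" using c4(1) by linarith
  then have "exp 1 \<le> c4 / \<epsilon>" using \<epsilon> by (simp add: pos_le_divide_eq)
  then have u: "1 \<le> u" using c4_pos \<epsilon> unfolding u_def by (subst ln_ge_iff) auto
  \<comment> \<open>Any \<open>i\<close> with \<open>x \<le> 2 ^ i\<close> gives
    \<open>threshold i \<le> \<epsilon>\<close>; the least one also keeps \<open>2 ^ i\<close>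
    linear in \<open>x\<close>.\<close>
  define i where "i = (LEAST i. x \<le> 2 ^ i)"
  have "\<exists>i. x < 2 ^ i" by (rule real_arch_pow) simp
  then have "\<exists>i. x \<le> 2 ^ i" using less_imp_le by blast
  then have i: "x \<le> 2 ^ i" unfolding i_def by (rule LeastI_ex)
  have i_upper: "2 ^ i \<le> 2 * x + 1"
  proof (cases i)
    case 0
    then show ?thesis using u q by (simp add: x_def)
  next
    case (Suc k)
    then have "\<not> x \<le> 2 ^ k" using not_less_Least[of k "\<lambda>i. x \<le> 2 ^ i"] by (simp add: i_def)
    then show ?thesis using Suc by simp
  qed
  have "threshold i \<le> \<epsilon>"
  proof -
    have "u \<le> 2 ^ i * q" using i q by (simp add: x_def pos_divide_le_eq)
    moreover have "ln (\<kappa> / r\<^sup>2) \<le> ln c4" using c4 \<kappa>_pos r_pos c4_pos by (subst ln_le_cancel_iff) auto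
    ultimately have "ln (\<kappa> / r\<^sup>2) - 2 ^ i * q \<le> ln \<epsilon>"
      using c4_pos \<epsilon> by (simp add: u_def ln_div)
    moreover have "ln (threshold i) = ln (\<kappa> / r\<^sup>2) - 2 ^ i * q"
      using \<kappa>_pos r_pos by (simp add: threshold_def q_def ln_mult ln_realpow ln_div)
    ultimately have "ln (threshold i) \<le> ln \<epsilon>" by simp
    then show ?thesis using threshold_pos[of i] \<epsilon> by simp
  qed
  then have "B / \<epsilon>\<^sup>2 * (1 + T (\<epsilon> / r)) \<le> 2 * B * D * Y ^ (m + i) / \<epsilon> ^ 4"
    using m \<epsilon> by (intro step_le)
  also have "\<dots> = 2 * B * D / \<epsilon> ^ 4 * Y ^ (m + i)" by simp
  also have "\<dots> \<le> 2 * B * D / \<epsilon> ^ 4 * (c3 * u) powr log 2 Y"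
  proof (intro mult_left_mono)
    have "2 ^ i \<le> (2 / q) * u + u" using i_upper u by (simp add: x_def)
    then have "2 ^ m * 2 ^ i \<le> 2 ^ m * ((2 / q + 1) * u)"
      by (intro mult_left_mono) (auto simp: algebra_simps)
    also have "\<dots> = 2 ^ m * (2 / q + 1) * u" by simp
    also have "\<dots> \<le> c3 * u" using c3 u by (intro mult_right_mono) (auto simp: q_def)
    finally have le: "2 ^ (m + i) \<le> c3 * u" by (simp add: power_add)
    \<comment> \<open>Exchanging base and exponent turns a power whose exponent is logarithmic in
      \<open>u\<close> into a fixed power of \<open>u\<close>.\<close>
    have "Y ^ (m + i) = (2 powr log 2 Y) powr real (m + i)"
      using Y_ge_1 by (subst powr_realpow) auto
    also have "\<dots> = (2 powr real (m + i)) powr log 2 Y"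
      by (simp only: powr_powr mult.commute)
    also have "\<dots> = (2 ^ (m + i)) powr log 2 Y"
      by (subst powr_realpow) auto
    also have "\<dots> \<le> (c3 * u) powr log 2 Y"
      using le Y_ge_1 by (intro powr_mono2) auto
    finally show "Y ^ (m + i) \<le> (c3 * u) powr log 2 Y" .
  qed (use B_nonneg D_nonneg in auto)
  finally show ?thesis by (simp add: u_def)
qed

end

section \<open>The number of calls is the same in all executions\<close>

context regularized_planning
begin

lemma call_counts_bind_const:
  assumes "\<And>x. call_counts (f x) = {b}"
  shows "call_counts (bind_prog p f) = (\<lambda>n. n + b) ` call_counts p"
  by (induction p) (auto simp: assms image_UN image_image)

lemma call_counts_for_each:
  assumes "\<And>b. b \<in> set bs \<Longrightarrow> call_counts (f b) = {n}"
  shows "call_counts (for_each bs f) = {length bs * n}"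
  using assms
proof (induction bs)
  case (Cons b bs)
  have "call_counts (for_each bs f \<bind> (\<lambda>xs. Return (x # xs))) = {length bs * n}" for x
    using Cons by (subst call_counts_bind_const[where b = 0]) auto
  then show ?case
    using Cons.prems by (simp add: call_counts_bind_const[where b = "length bs * n"] ac_simps)
qed simp

lemma space_law: "s \<in> space S \<Longrightarrow> a \<in> set acts \<Longrightarrow> space (law s a) = {0..1} \<times> space S"
  using law[of s a] sets_eq_imp_space_eq[of "law s a"]
  by (simp add: space_prob_algebra space_pair_measure space_restrict_space)

text \<open>\<open>call_counts_bind_const\<close> would ask for the count after every response, even
  outside the state space, whereas the count of \<open>sampleV\<close> is established only on
  \<open>space S\<close>. Since \<open>s\<close> lies in it, the union over the responses is not
  empty.\<close>

lemma call_counts_call: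
  assumes "s \<in> space S" "a \<in> set acts" "\<And>R Z. Z \<in> space S \<Longrightarrow> call_counts (f R Z) = {n}"
  shows "call_counts (bind_prog (call_model s a) (\<lambda>(R, Z). f R Z)) = {Suc n}"
  using assms by (force simp: call_model_def space_law)

lemma sum_fun_upd:
  assumes "a \<in> set acts"
  shows "(\<Sum>b\<in>set acts. h ((x(a := t)) b)) = h t + (\<Sum>b\<in>set acts - {a}. h (x b :: real) :: real)"
  using assms by (subst sum.remove[of _ a]) (auto intro!: sum.cong)

text \<open>The partial derivative is a softmax weight. Its positivity ensures that some action can
  be drawn, so that the set of counts after a draw is not empty.\<close>

lemma gradF_pos:
  assumes a: "a \<in> set acts"
  shows "0 < gradF s x a"
proof -
  \<comment> \<open>The sign treats maximizer and minimizer at once; in the derivative it occurs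
    squared and disappears.\<close>
  define \<sigma> :: real where "\<sigma> = (if s \<in> Mx then 1 else - 1)"
  define C where "C = (\<Sum>b\<in>set acts - {a}. exp (\<sigma> * x b / l))"
  have C: "0 \<le> C" by (auto simp: C_def intro: sum_nonneg)
  have "F s y = \<sigma> * l * ln (\<Sum>b\<in>set acts. exp (\<sigma> * y b / l))" for y
    by (simp add: F_def \<sigma>_def)
  then have eq: "F s (x(a := t)) = \<sigma> * l * ln (exp (\<sigma> * t / l) + C)" for t
    by (simp only: sum_fun_upd[OF a, of "\<lambda>y. exp (\<sigma> * y / l)"] C_def)
  have pos: "0 < exp (\<sigma> * t / l) + C" for t using C by (simp add: add_pos_nonneg)
  have "\<sigma> * \<sigma> = 1" by (simp add: \<sigma>_def)
  then have "((\<lambda>t. F s (x(a := t))) has_real_derivative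
      exp (\<sigma> * x a / l) / (exp (\<sigma> * x a / l) + C)) (at (x a))"
    unfolding eq using l_pos pos
    by (auto intro!: derivative_eq_intros)
  then have "gradF s x a = exp (\<sigma> * x a / l) / (exp (\<sigma> * x a / l) + C)"
    unfolding gradF_def by (rule DERIV_imp_deriv)
  then show ?thesis using pos by simp
qed

context
  fixes \<delta> :: real
begin

text \<open>The control flow of \<open>sampleV\<close> depends on the accuracy alone, so the state
  is dropped and the count of \<open>estimateQ\<close> is inlined.\<close>

function sampleV_calls :: "real \<Rightarrow> nat" where
  "sampleV_calls \<epsilon> =
     (if \<epsilon> \<le> 0 \<or> vmax \<le> \<epsilon> then 0
      else if \<kappa> \<le> \<epsilon> then
        K * (num_samples K l g \<delta> \<epsilon> * Suc (sampleV_calls (coarser K l g \<epsilon>)))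
      else
        K * (num_samples K l g \<delta> (sqrt (\<kappa> * \<epsilon>)) *
          Suc (sampleV_calls (coarser K l g (sqrt (\<kappa> * \<epsilon>))))) +
        Suc (sampleV_calls (coarser K l g \<epsilon>)))"
  by pat_completeness auto

termination
proof (relation "Wellfounded.measure rank", goal_cases)
  case (3 \<epsilon>)
  then have "\<epsilon> \<le> sqrt (\<kappa> * \<epsilon>)" by (intro real_le_rsqrt) (simp add: power2_eq_square)
  then have "rank (coarser K l g (sqrt (\<kappa> * \<epsilon>))) \<le> rank (coarser K l g \<epsilon>)"
    using 3 by (intro rank_mono coarser_mono coarser_pos) auto
  then show ?case using rank_coarser[of \<epsilon>] 3 by simp
qed (auto intro!: rank_coarser)

declare sampleV_calls.simps [simp del] sampleV.simps [simp del] estimateQ.simps [simp del]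

definition estimateQ_calls :: "real \<Rightarrow> nat" where
  "estimateQ_calls \<epsilon> = K * (num_samples K l g \<delta> \<epsilon> * Suc (sampleV_calls (coarser K l g \<epsilon>)))"

text \<open>The count of the nested \<open>sampleV\<close> is a hypothesis, so that this applies to
  the induction hypotheses of \<open>call_counts_sampleV\<close>.\<close>

lemma call_counts_estimateQ_aux:
  assumes "\<And>Z. Z \<in> space S \<Longrightarrow> call_counts (sampleV \<delta> Z (coarser K l g \<epsilon>)) = {n}" "s \<in> space S"
  shows "call_counts (estimateQ \<delta> s \<epsilon>) = {K * (num_samples K l g \<delta> \<epsilon> * Suc n)}"
proof -
  have "call_counts (do { (R, Z) \<leftarrow> call_model s a;
               V \<leftarrow> sampleV \<delta> Z (coarser K l g \<epsilon>);
               Return (R + g * V) }) = {Suc n}" if "a \<in> set acts" for a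
    using assms that
    by (intro call_counts_call) (auto simp: call_counts_bind_const[where b = 0])
  then show ?thesis
    unfolding estimateQ.simps
    by (subst call_counts_bind_const[where b = 0], simp,
        subst call_counts_for_each[where n = "num_samples K l g \<delta> \<epsilon> * Suc n"])
      (auto simp: call_counts_bind_const[where b = 0] call_counts_for_each[where n = "Suc n"])
qed

lemma call_counts_sampleV:
  "s \<in> space S \<Longrightarrow> call_counts (sampleV \<delta> s \<epsilon>) = {sampleV_calls \<epsilon>}"
proof (induction \<epsilon> arbitrary: s rule: sampleV_calls.induct)
  case (1 \<epsilon>)
  consider "\<epsilon> \<le> 0 \<or> vmax \<le> \<epsilon>" | "0 < \<epsilon>" "\<epsilon> < vmax" "\<kappa> \<le> \<epsilon>" | "0 < \<epsilon>" "\<epsilon> < vmax" "\<epsilon> < \<kappa>"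
    by linarith
  then show ?case
  proof cases
    case 1
    then show ?thesis by (auto simp: sampleV.simps[of \<delta> s \<epsilon>] sampleV_calls.simps[of \<epsilon>])
  next
    case 2
    then have "call_counts (estimateQ \<delta> s \<epsilon>) =
      {K * (num_samples K l g \<delta> \<epsilon> * Suc (sampleV_calls (coarser K l g \<epsilon>)))}"
      using 1 by (intro call_counts_estimateQ_aux) auto
    then show ?thesis using 2
      by (simp add: sampleV.simps[of \<delta> s \<epsilon>] sampleV_calls.simps[of \<epsilon>] call_counts_bind_const[where b = 0])
  next
    case 3
    let ?n = "sampleV_calls (coarser K l g \<epsilon>)"
    have est: "call_counts (estimateQ \<delta> s (sqrt (\<kappa> * \<epsilon>))) =
      {K * (num_samples K l g \<delta> (sqrt (\<kappa> * \<epsilon>)) *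
        Suc (sampleV_calls (coarser K l g (sqrt (\<kappa> * \<epsilon>)))))}"
      using 1 3 by (intro call_counts_estimateQ_aux) auto
    have "call_counts (do { (R, Z) \<leftarrow> call_model s A;
          V \<leftarrow> sampleV \<delta> Z (coarser K l g \<epsilon>);
          Return (F s Q - (\<Sum>a\<in>set acts. Q a * gradF s Q a) + (R + g * V)) }) = {Suc ?n}"
      if "A \<in> set acts" for A Q
      using 1 3 that by (intro call_counts_call) (auto simp: call_counts_bind_const[where b = 0])
    then have "call_counts (do { A \<leftarrow> draw_action (gradF s Q);
          (R, Z) \<leftarrow> call_model s A;
          V \<leftarrow> sampleV \<delta> Z (coarser K l g \<epsilon>);
          Return (F s Q - (\<Sum>a\<in>set acts. Q a * gradF s Q a) + (R + g * V)) }) = {Suc ?n}" for Q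
      using set_empty[of acts] acts_ne gradF_pos by (auto simp: draw_action_def simp del: set_empty)
    then show ?thesis using 3 est
      by (simp add: sampleV.simps[of \<delta> s \<epsilon>] sampleV_calls.simps[of \<epsilon>] call_counts_bind_const[where b = "Suc ?n"])
  qed
qed

lemma call_counts_smooth_cruiser:
  "s \<in> space S \<Longrightarrow> call_counts (smooth_cruiser \<delta> s \<epsilon>) = {estimateQ_calls \<epsilon>}"
  using call_counts_estimateQ_aux call_counts_sampleV
  by (simp add: smooth_cruiser_def estimateQ_calls_def call_counts_bind_const[where b = 0])

lemma sampleV_calls_eq_0: "vmax \<le> \<epsilon> \<Longrightarrow> sampleV_calls \<epsilon> = 0"
  by (simp add: sampleV_calls.simps[of \<epsilon>])

lemma sampleV_calls_mid:
  "\<kappa> \<le> \<epsilon> \<Longrightarrow> \<epsilon> < vmax \<Longrightarrow> sampleV_calls \<epsilon> = estimateQ_calls \<epsilon>"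
  using kappa_pos by (simp add: sampleV_calls.simps[of \<epsilon>] estimateQ_calls_def)

lemma sampleV_calls_low:
  "0 < \<epsilon> \<Longrightarrow> \<epsilon> < \<kappa> \<Longrightarrow> \<epsilon> < vmax \<Longrightarrow>
    sampleV_calls \<epsilon> = estimateQ_calls (sqrt (\<kappa> * \<epsilon>)) + Suc (sampleV_calls (coarser K l g \<epsilon>))"
  by (simp add: sampleV_calls.simps[of \<epsilon>] estimateQ_calls_def)

end

end

section \<open>The counts satisfy the recurrence\<close>

text \<open>For \<open>g = 0\<close> the recursive call at accuracy \<open>coarser\<close> is free, so any ratio below \<open>1\<close> will do.\<close>

definition ratio :: "real \<Rightarrow> real" where
  "ratio g = (if g = 0 then 1 / 2 else sqrt g)"

lemma ratio_bounds: "0 \<le> g \<Longrightarrow> g < 1 \<Longrightarrow> 0 < ratio g \<and> ratio g < 1"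
  by (auto simp: ratio_def)

text \<open>The second summand absorbs the rounding up in \<open>num_samples\<close>.\<close>

definition sample_coeff :: "nat \<Rightarrow> real \<Rightarrow> real \<Rightarrow> real" where
  "sample_coeff K l g = 18 * (1 + M_const K l)\<^sup>2 / ((1 - g) ^ 4 * (1 - sqrt g)\<^sup>2)
     + (max (max_value K l g) (kappa K l g))\<^sup>2"

text \<open>For \<open>\<epsilon>\<close> in this range the rounding error 1 is at most
  \<open>W\<^sup>2 / \<epsilon>\<^sup>2\<close>. The factor \<open>exp 1\<close> adds 1 to the
  logarithm \<open>u > 0\<close>, so that the sum can multiply this term as well.\<close>

lemma num_samples_le:
  assumes "0 < \<epsilon>" "\<epsilon> \<le> max (max_value K l g) (kappa K l g)" "0 < \<delta>" "\<delta> < 2 * real K"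
  shows "real (num_samples K l g \<delta> \<epsilon>) \<le> sample_coeff K l g * ln (2 * real K * exp 1 / \<delta>) / \<epsilon>\<^sup>2"
proof -
  define C where "C = 18 * (1 + M_const K l)\<^sup>2 / ((1 - g) ^ 4 * (1 - sqrt g)\<^sup>2)"
  define W where "W = max (max_value K l g) (kappa K l g)"
  define u where "u = ln (2 * real K / \<delta>)"
  have K: "0 < real K" using assms by linarith
  have C: "0 \<le> C" by (simp add: C_def)
  have u: "0 < u" using assms by (simp add: u_def)
  have ln_eq: "ln (2 * real K * exp 1 / \<delta>) = u + 1"
    using K assms by (simp add: u_def ln_mult ln_div)
  have "real (num_samples K l g \<delta> \<epsilon>) \<le> C * (u / \<epsilon>\<^sup>2) + 1"
    using C u by (simp add: num_samples_def flip: C_def u_def)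
  moreover have "\<epsilon>\<^sup>2 \<le> W\<^sup>2" using assms by (intro power_mono) (auto simp: W_def)
  then have "1 \<le> W\<^sup>2 / \<epsilon>\<^sup>2" using assms(1) by (simp add: pos_le_divide_eq)
  ultimately have "real (num_samples K l g \<delta> \<epsilon>) \<le> C * (u / \<epsilon>\<^sup>2) + W\<^sup>2 / \<epsilon>\<^sup>2"
    by linarith
  also have "\<dots> = (C * u + W\<^sup>2) / \<epsilon>\<^sup>2" by (simp add: add_divide_distrib)
  also have "\<dots> \<le> (C + W\<^sup>2) * (u + 1) / \<epsilon>\<^sup>2"
    using C u by (intro divide_right_mono) (auto simp: algebra_simps)
  finally show ?thesis by (simp add: ln_eq sample_coeff_def C_def W_def)
qed

lemma sample_coeff_nonneg: "0 \<le> sample_coeff K l g"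
  by (simp add: sample_coeff_def)

context regularized_planning
begin

lemma sampleV_calls_coarser_le:
  "0 < \<epsilon> \<Longrightarrow> sampleV_calls \<delta> (coarser K l g \<epsilon>) \<le> sampleV_calls \<delta> (\<epsilon> / ratio g)"
proof (cases "g = 0")
  case True
  then have "coarser K l g \<epsilon> = vmax" by (simp add: coarser_def)
  then show ?thesis by (simp only: sampleV_calls_eq_0)
qed (simp add: coarser_def ratio_def)

lemma estimateQ_calls_le:
  assumes "0 < \<epsilon>" "\<epsilon> \<le> max vmax \<kappa>" "0 < \<delta>" "\<delta> < 2 * real K"
  shows "real (estimateQ_calls \<delta> \<epsilon>) \<le>
    real K * sample_coeff K l g * ln (2 * real K * exp 1 / \<delta>) / \<epsilon>\<^sup>2 *
      (1 + real (sampleV_calls \<delta> (\<epsilon> / ratio g)))"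
proof -
  let ?b = "sample_coeff K l g * ln (2 * real K * exp 1 / \<delta>) / \<epsilon>\<^sup>2"
  have N: "real (num_samples K l g \<delta> \<epsilon>) \<le> ?b" using assms by (rule num_samples_le)
  have "real (estimateQ_calls \<delta> \<epsilon>) =
      real K * (real (num_samples K l g \<delta> \<epsilon>) * (1 + real (sampleV_calls \<delta> (coarser K l g \<epsilon>))))"
    by (simp add: estimateQ_calls_def distrib_left)
  also have "\<dots> \<le> real K * (?b * (1 + real (sampleV_calls \<delta> (\<epsilon> / ratio g))))"
    using N assms(1) sampleV_calls_coarser_le by (intro mult_mono) auto
  finally show ?thesis by (simp add: mult_ac)
qed

lemma call_recurrence_sampleV_calls:
  assumes "0 < \<delta>" "\<delta> < 2 * real K"
    and B: "B = real K * sample_coeff K l g * ln (2 * real K * exp 1 / \<delta>)"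
    and "(max vmax \<kappa> / ratio g)\<^sup>2 \<le> D"
    and "(2 * B / \<kappa>\<^sup>2 + 1) / (1 - (ratio g)\<^sup>2) \<le> Y"
  shows "call_recurrence (\<lambda>\<epsilon>. real (sampleV_calls \<delta> \<epsilon>)) vmax \<kappa> (ratio g) B D Y"
proof
  show "0 < ratio g" "ratio g < 1" using ratio_bounds g_nonneg g_less_1 by auto
  have "2 * real K * 1 \<le> 2 * real K * exp 1" by (intro mult_left_mono) auto
  then have "\<delta> \<le> 2 * real K * exp 1" using assms(2) by linarith
  then have "1 \<le> 2 * real K * exp 1 / \<delta>" using assms(1) by (simp add: pos_le_divide_eq)
  then show "0 \<le> B" by (simp add: B sample_coeff_nonneg)
  fix \<epsilon> :: real
  show "real (sampleV_calls \<delta> \<epsilon>) = 0" if "vmax \<le> \<epsilon>"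
    using that by (simp add: sampleV_calls_eq_0)
  show "real (sampleV_calls \<delta> \<epsilon>) \<le> B / \<epsilon>\<^sup>2 * (1 + real (sampleV_calls \<delta> (\<epsilon> / ratio g)))"
    if "\<kappa> \<le> \<epsilon>" "\<epsilon> < vmax"
    using that kappa_pos assms estimateQ_calls_le[of \<epsilon> \<delta>] by (simp add: sampleV_calls_mid)
  show "real (sampleV_calls \<delta> \<epsilon>) \<le>
      B / (\<kappa> * \<epsilon>) * (1 + real (sampleV_calls \<delta> (sqrt (\<kappa> * \<epsilon>) / ratio g))) + 1 +
      real (sampleV_calls \<delta> (\<epsilon> / ratio g))"
    if \<epsilon>: "0 < \<epsilon>" "\<epsilon> < \<kappa>" "\<epsilon> < vmax"
  proof -
    \<comment> \<open>This puts the accuracy of the nested \<open>estimateQ\<close> in the range of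
      \<open>estimateQ_calls_le\<close>; its square \<open>\<kappa> * \<epsilon>\<close> is the
      denominator in \<open>T_low\<close>.\<close>
    have "sqrt (\<kappa> * \<epsilon>) \<le> \<kappa>" using \<epsilon> kappa_pos
      by (intro real_le_lsqrt) (auto simp: power2_eq_square)
    then have "real (estimateQ_calls \<delta> (sqrt (\<kappa> * \<epsilon>))) \<le>
        B / (\<kappa> * \<epsilon>) * (1 + real (sampleV_calls \<delta> (sqrt (\<kappa> * \<epsilon>) / ratio g)))"
      using \<epsilon> kappa_pos assms estimateQ_calls_le[of "sqrt (\<kappa> * \<epsilon>)" \<delta>] by simp
    then show ?thesis
      using \<epsilon> sampleV_calls_coarser_le[of \<epsilon> \<delta>] by (simp add: sampleV_calls_low)
  qed
qed (use vmax_pos kappa_pos assms in auto)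

text \<open>The logarithm in \<open>num_samples\<close> is then nonpositive and \<open>nat\<close>
  truncates to 0. This settles the \<open>\<delta>\<close> from \<open>2 * real K\<close> up to
  \<open>2 * real K * exp 1\<close>, which \<open>num_samples_le\<close> leaves out.\<close>

lemma estimateQ_calls_eq_0: "\<delta> \<ge> 2 * real K \<Longrightarrow> estimateQ_calls \<delta> \<epsilon> = 0"
proof -
  assume \<delta>: "\<delta> \<ge> 2 * real K"
  have K: "0 < real K" using acts_ne by simp
  have "2 * real K / \<delta> \<le> 1" using \<delta> K by (subst divide_le_eq_1_pos) linarith+
  moreover have "0 < 2 * real K / \<delta>" using \<delta> K by (intro divide_pos_pos) linarith+
  ultimately have "ln (2 * real K / \<delta>) \<le> 0" by (subst ln_le_zero_iff) auto
  then have "18 * (1 + M_const K l)\<^sup>2 / ((1 - g) ^ 4 * (1 - sqrt g)\<^sup>2)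
      * (ln (2 * real K / \<delta>) / \<epsilon>\<^sup>2) \<le> 0"
    by (intro mult_nonneg_nonpos divide_nonpos_nonneg) auto
  then have "num_samples K l g \<delta> \<epsilon> = 0" unfolding num_samples_def by linarith
  then show "estimateQ_calls \<delta> \<epsilon> = 0" by (simp add: estimateQ_calls_def)
qed

end

section \<open>Asymptotics of the bound and choice of the constants\<close>

text \<open>For fixed \<open>\<delta>\<close> the exponent is a constant. Near 0 the base is at
  least 1, so the exponent may be rounded up to a natural number, and \<open>c4 / \<epsilon>\<close>
  is at most \<open>1 / \<epsilon> ^ 4\<close>.\<close>

lemma call_bound_soft_bigo:
  assumes "0 < c3" "0 < c4"
  shows "(\<lambda>\<epsilon>. call_bound c1 c2 c3 c4 c5 \<epsilon> \<delta>) \<in> soft_bigo (at_right 0) (\<lambda>\<epsilon>. 1 / \<epsilon> ^ 4)"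
proof -
  define p where "p = log 2 (c5 * ln (c2 / \<delta>))"
  define k where "k = nat \<lceil>p\<rceil>"
  have p: "p \<le> real k" unfolding k_def by linarith
  have "eventually (\<lambda>\<epsilon>. 1 \<le> c3 * ln (c4 / \<epsilon>)) (at_right 0)"
    using assms by real_asymp
  moreover have "eventually (\<lambda>\<epsilon>. c3 * ln (c4 / \<epsilon>) \<le> c3 * ln (1 / \<epsilon> ^ 4)) (at_right 0)"
    using assms by real_asymp
  moreover have "eventually (\<lambda>\<epsilon>::real. 0 < \<epsilon>) (at_right 0)"
    by (simp add: eventually_at_right_less)
  ultimately have "eventually (\<lambda>\<epsilon>. norm (call_bound c1 c2 c3 c4 c5 \<epsilon> \<delta>) \<le>
      \<bar>c1 * ln (c2 / \<delta>)\<bar> * c3 ^ k * norm (1 / \<epsilon> ^ 4 * ln (1 / \<epsilon> ^ 4) ^ k)) (at_right 0)"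
  proof eventually_elim
    case (elim \<epsilon>)
    have "(c3 * ln (c4 / \<epsilon>)) powr p \<le> (c3 * ln (c4 / \<epsilon>)) powr real k"
      using elim p by (intro powr_mono) auto
    also have "\<dots> = (c3 * ln (c4 / \<epsilon>)) ^ k"
      using elim by (intro powr_realpow) auto
    also have "\<dots> \<le> (c3 * ln (1 / \<epsilon> ^ 4)) ^ k"
      using elim by (intro power_mono) auto
    also have "\<dots> \<le> c3 ^ k * \<bar>ln (1 / \<epsilon> ^ 4)\<bar> ^ k"
      unfolding power_mult_distrib power_abs[symmetric] using assms by (intro mult_left_mono) auto
    finally have le: "(c3 * ln (c4 / \<epsilon>)) powr p \<le> c3 ^ k * \<bar>ln (1 / \<epsilon> ^ 4)\<bar> ^ k" .
    have "norm (call_bound c1 c2 c3 c4 c5 \<epsilon> \<delta>) =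
        \<bar>c1 * ln (c2 / \<delta>)\<bar> / \<epsilon> ^ 4 * (c3 * ln (c4 / \<epsilon>)) powr p"
      using elim by (simp add: call_bound_def abs_mult p_def)
    also have "\<dots> \<le> \<bar>c1 * ln (c2 / \<delta>)\<bar> / \<epsilon> ^ 4 * (c3 ^ k * \<bar>ln (1 / \<epsilon> ^ 4)\<bar> ^ k)"
      using le elim by (intro mult_left_mono) auto
    also have "\<dots> = \<bar>c1 * ln (c2 / \<delta>)\<bar> * c3 ^ k * norm (1 / \<epsilon> ^ 4 * ln (1 / \<epsilon> ^ 4) ^ k)"
      by (simp add: abs_mult power_abs)
    finally show ?case .
  qed
  then have "(\<lambda>\<epsilon>. call_bound c1 c2 c3 c4 c5 \<epsilon> \<delta>) \<in> O[at_right 0](\<lambda>\<epsilon>. 1 / \<epsilon> ^ 4 * ln (1 / \<epsilon> ^ 4) ^ k)"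
    by (rule bigoI)
  then show ?thesis unfolding soft_bigo_def by blast
qed

theorem theorem1:
  fixes K :: nat and l g :: real
  assumes "K \<ge> 1" and "l > 0" and "0 \<le> g" and "g < 1"
  shows "\<exists>c1 c2 c3 c4 c5 :: real.
    c1 > 0 \<and> c2 \<ge> 2 * real K \<and> c3 > 0 \<and> c4 > max_value K l g \<and> c5 > 0 \<and>
    (\<forall>(S :: 's measure) (acts :: 'a list) P rew law Mx.
       regularized_planning S acts P rew law Mx l g \<and> length acts = K \<longrightarrow>
       (\<forall>\<epsilon> \<delta>. 0 < \<epsilon> \<and> \<epsilon> \<le> max_value K l g \<and> 0 < \<delta> \<and> \<delta> < c2 \<longrightarrow>
         (\<exists>n :: nat.
           (\<forall>s\<in>space S.
              regularized_planning.call_counts acts law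
                (regularized_planning.smooth_cruiser acts Mx l g \<delta> s \<epsilon>) = {n}) \<and>
           real n \<le> call_bound c1 c2 c3 c4 c5 \<epsilon> \<delta>))) \<and>
    (\<forall>\<delta>. 0 < \<delta> \<and> \<delta> < c2 \<longrightarrow>
       (\<lambda>\<epsilon>. call_bound c1 c2 c3 c4 c5 \<epsilon> \<delta>) \<in> soft_bigo (at_right 0) (\<lambda>\<epsilon>. 1 / \<epsilon>^4))"
proof -
  define v where "v = max_value K l g"
  define \<kappa> where "\<kappa> = kappa K l g"
  define r where "r = ratio g"
  define A where "A = sample_coeff K l g"
  define D where "D = (max v \<kappa> / r)\<^sup>2"
  have r: "0 < r" "r < 1" using ratio_bounds assms by (auto simp: r_def)
  have r2: "0 < r\<^sup>2" "r\<^sup>2 < 1" using r by (auto simp: power_less_one_iff)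
  have v: "0 < v" using assms by (auto simp: v_def max_value_def M_const_def intro!: divide_pos_pos add_pos_nonneg)
  have \<kappa>: "0 < \<kappa>" using assms by (auto simp: \<kappa>_def kappa_def)
  have "0 < (max v \<kappa>)\<^sup>2" using v by simp
  then have A: "0 < A" unfolding A_def sample_coeff_def v_def \<kappa>_def
    by (intro add_nonneg_pos) auto
  have D: "0 < D" using v r by (simp add: D_def)
  \<comment> \<open>\<open>m\<close> divisions by \<open>r\<close> lead from \<open>\<kappa>\<close>
    to \<open>v\<close>; their number depends only on \<open>K\<close>, \<open>l\<close> and
    \<open>g\<close>.\<close>
  obtain m where "r ^ m < \<kappa> / v" using real_arch_pow_inv[of "\<kappa> / v" r] r v \<kappa> by auto
  then have m: "v * r ^ m \<le> \<kappa>" using v by (simp add: field_simps)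
  \<comment> \<open>With \<open>B = real K * A * h\<close> and
    \<open>h = ln (c2 / \<delta>)\<close>, \<open>c1 * h\<close> is \<open>2 * B * D\<close>;
    \<open>c3\<close> and \<open>c4\<close> are the least values that \<open>step_le_log\<close>
    admits; \<open>c5\<close> is chosen so that \<open>Y = c5 * h\<close> is admissible once
    \<open>1 \<le> h\<close>.\<close>
  define c1 where "c1 = 2 * real K * A * D"
  define c2 where "c2 = 2 * real K * exp 1"
  define c3 where "c3 = 2 ^ m * (2 / ln (1 / r\<^sup>2) + 1)"
  define c4 where "c4 = max (exp 1 * v) (\<kappa> / r\<^sup>2)"
  define c5 where "c5 = (2 * real K * A / \<kappa>\<^sup>2 + 1) / (1 - r\<^sup>2)"
  have e: "1 < exp (1::real)" by simp
  have c1: "0 < c1" using assms A D by (simp add: c1_def)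
  have c2: "2 * real K \<le> c2" using assms e unfolding c2_def by (intro mult_le_cancel_left1[THEN iffD2]) auto
  have c3: "0 < c3" using r2 unfolding c3_def by (intro mult_pos_pos add_nonneg_pos) auto
  have c4: "v < c4" using v e by (simp add: c4_def less_max_iff_disj)
  have c5: "0 < c5" using A r2 unfolding c5_def by (intro divide_pos_pos add_nonneg_pos) auto
  have count: "\<exists>n. (\<forall>s\<in>space S. regularized_planning.call_counts acts law
        (regularized_planning.smooth_cruiser acts Mx l g \<delta> s \<epsilon>) = {n}) \<and>
      real n \<le> call_bound c1 c2 c3 c4 c5 \<epsilon> \<delta>"
    if loc: "regularized_planning S acts P rew law Mx l g" and len: "length acts = K"
      and \<epsilon>: "0 < \<epsilon>" "\<epsilon> \<le> v" and \<delta>: "0 < \<delta>" "\<delta> < c2"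
    for S :: "'s measure" and acts :: "'a list" and P rew law Mx \<epsilon> \<delta>
  proof -
    interpret regularized_planning S acts P rew law Mx l g by (rule loc)
    have "real (estimateQ_calls \<delta> \<epsilon>) \<le> call_bound c1 c2 c3 c4 c5 \<epsilon> \<delta>"
    proof (cases "2 * real K \<le> \<delta>")
      case True
      have "0 \<le> call_bound c1 c2 c3 c4 c5 \<epsilon> \<delta>"
        using c1 \<delta> \<epsilon> by (simp add: call_bound_def)
      then show ?thesis using True len by (simp add: estimateQ_calls_eq_0)
    next
      case False
      define h where "h = ln (c2 / \<delta>)"
      define B where "B = real K * A * h"
      \<comment> \<open>Here the factor \<open>exp 1\<close> in \<open>c2\<close> gives
        \<open>1 \<le> h\<close>, so the summand 1 in the lower bound for \<open>Y\<close> is at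
        most \<open>h\<close> and the whole bound is linear in \<open>h\<close>.\<close>
      have "exp 1 \<le> c2 / \<delta>" using False \<delta> by (simp add: c2_def field_simps)
      then have h: "1 \<le> h" using \<delta> c2 unfolding h_def by (subst ln_ge_iff) auto
      have "(2 * B / \<kappa>\<^sup>2 + 1) / (1 - r\<^sup>2) \<le> (2 * real K * A / \<kappa>\<^sup>2 * h + 1 * h) / (1 - r\<^sup>2)"
        using h r2 by (intro divide_right_mono add_mono) (auto simp: B_def mult_ac)
      also have "\<dots> = c5 * h" by (simp add: c5_def distrib_right)
      finally have Y: "(2 * B / \<kappa>\<^sup>2 + 1) / (1 - r\<^sup>2) \<le> c5 * h" .
      interpret call_recurrence "\<lambda>\<epsilon>. real (sampleV_calls \<delta> \<epsilon>)" v \<kappa> r B D "c5 * h"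
        unfolding v_def \<kappa>_def r_def len[symmetric]
        using False \<delta> Y by (intro call_recurrence_sampleV_calls)
          (auto simp: B_def h_def c2_def A_def D_def v_def \<kappa>_def r_def len)
      have "real (estimateQ_calls \<delta> \<epsilon>) \<le> B / \<epsilon>\<^sup>2 * (1 + real (sampleV_calls \<delta> (\<epsilon> / r)))"
        using estimateQ_calls_le[of \<epsilon> \<delta>] \<epsilon> \<delta> False
        by (simp add: len B_def h_def c2_def A_def v_def r_def)
      also have "\<dots> \<le> 2 * B * D / \<epsilon> ^ 4 * (c3 * ln (c4 / \<epsilon>)) powr log 2 (c5 * h)"
        using m \<epsilon> by (intro step_le_log) (auto simp: c3_def c4_def)
      also have "\<dots> = call_bound c1 c2 c3 c4 c5 \<epsilon> \<delta>"
        by (simp add: call_bound_def B_def c1_def h_def mult_ac)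
      finally show ?thesis .
    qed
    then show ?thesis using call_counts_smooth_cruiser by blast
  qed
  show ?thesis
  proof (rule exI[of _ c1], rule exI[of _ c2], rule exI[of _ c3], rule exI[of _ c4],
      rule exI[of _ c5], intro conjI allI impI; (elim conjE)?)
    show "max_value K l g < c4" using c4 by (simp only: v_def)
    show "(\<lambda>\<epsilon>. call_bound c1 c2 c3 c4 c5 \<epsilon> \<delta>) \<in> soft_bigo (at_right 0) (\<lambda>\<epsilon>. 1 / \<epsilon> ^ 4)" for \<delta>
      using c3 v c4 by (intro call_bound_soft_bigo) auto
  qed (fact c1 c2 c3 c5 | rule count; (unfold v_def)?; assumption)+
qed

end
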